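(* Let $\epsilon$ be a fixed rational constant. For integers $1\le m\le n$, let $B=\mathbf{J}_{m\times n}+\epsilon I_{m,n}\in\mathbb{Q}^{m\times n}$, where $\mathbf{J}_{m\times n}$ is the all-ones $m\times n$ matrix and $I_{m,n}$ is the submatrix of the $n\times n$ identity matrix consisting of its first $m$ rows. Then the Moore–Penrose pseudoinverse $B^+$ satisfies $RES(B^+)=O(\log n)$.
   Context: The resolution of a rational number $a/b$ with $a,b\in\mathbb{Z}$ coprime and $b\neq 0$ is $RES(a/b)=\lceil\max\{\log_2|a+1|,\log_2|b+1|\}\rceil$. For a rational matrix $A=(a_{ij})$, $RES(A)=\max_{i,j}RES(a_{ij})$. *)

theory Defs
  imports "Jordan_Normal_Form.Matrix" "HOL-Library.Landau_Symbols"
begin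

text \<open>
  The representation \<open>a/b\<close> is the normalised one, \<open>b > 0\<close>. Then \<open>log 2 \<bar>b + 1\<bar> \<ge> 1\<close>, so for
  \<open>a = -1\<close> the library value \<open>log 2 0 = 0\<close> and the conventional value \<open>-\<infinity>\<close> give the same maximum.
\<close>

definition RES :: "rat \<Rightarrow> int" where
  "RES q = (case quotient_of q of (a, b) \<Rightarrow>
     \<lceil>max (log 2 \<bar>real_of_int (a + 1)\<bar>) (log 2 \<bar>real_of_int (b + 1)\<bar>)\<rceil>)"

definition RES_mat :: "rat mat \<Rightarrow> int" where
  "RES_mat A = Max {RES (A $$ (i, j)) | i j. i < dim_row A \<and> j < dim_col A}"

text \<open>
  The four Penrose conditions; over an ordered field the adjoint is the transpose. For a rational
  matrix the real pseudoinverse has rational entries, hence is also the pseudoinverse over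
  the rationals.
\<close>

definition is_pseudoinverse :: "'a :: linordered_field mat \<Rightarrow> 'a mat \<Rightarrow> bool" where
  "is_pseudoinverse A X \<longleftrightarrow>
     X \<in> carrier_mat (dim_col A) (dim_row A) \<and>
     A * X * A = A \<and> X * A * X = X \<and>
     transpose_mat (A * X) = A * X \<and> transpose_mat (X * A) = X * A"

definition pseudoinverse :: "'a :: linordered_field mat \<Rightarrow> 'a mat" where
  "pseudoinverse A = (THE X. is_pseudoinverse A X)"

lemma is_pseudoinverse_unique:
  assumes X: "is_pseudoinverse A X" and Y: "is_pseudoinverse A Y"
  shows "X = Y"
proof -
  define m n where "m = dim_row A" and "n = dim_col A"
  have A: "A \<in> carrier_mat m n" and cX: "X \<in> carrier_mat n m" and cY: "Y \<in> carrier_mat n m"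
    using X Y by (auto simp: m_def n_def is_pseudoinverse_def)
  have X1: "A * X * A = A" and X2: "X * A * X = X"
    and X3: "transpose_mat (A * X) = A * X" and X4: "transpose_mat (X * A) = X * A"
    using X by (auto simp: is_pseudoinverse_def)
  have Y1: "A * Y * A = A" and Y2: "Y * A * Y = Y"
    and Y3: "transpose_mat (A * Y) = A * Y" and Y4: "transpose_mat (Y * A) = Y * A"
    using Y by (auto simp: is_pseudoinverse_def)
  have AX: "A * X \<in> carrier_mat m m" and AY: "A * Y \<in> carrier_mat m m"
    and XA: "X * A \<in> carrier_mat n n" and YA: "Y * A \<in> carrier_mat n n"
    using A cX cY by auto
  have "A * X = transpose_mat ((A * Y) * (A * X))"
    using X3 Y1 assoc_mult_mat[OF AY A cX] by simp
  also have "\<dots> = (A * X) * (A * Y)"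
    using transpose_mult[OF AY AX] X3 Y3 by simp
  also have "\<dots> = A * Y"
    using X1 assoc_mult_mat[OF AX A cY] by simp
  finally have eq1: "A * X = A * Y" .
  have "X * A = transpose_mat ((X * A) * (Y * A))"
    using X4 Y1 assoc_mult_mat[OF cX A YA] assoc_mult_mat[OF A cY A] by simp
  also have "\<dots> = (Y * A) * (X * A)"
    using transpose_mult[OF XA YA] X4 Y4 by simp
  also have "\<dots> = Y * A"
    using X1 assoc_mult_mat[OF cY A XA] assoc_mult_mat[OF A cX A] by simp
  finally have eq2: "X * A = Y * A" .
  have "X = (Y * A) * X" using X2 eq2 by simp
  also have "\<dots> = Y * A * Y" using eq1 assoc_mult_mat[OF cY A cX] assoc_mult_mat[OF cY A cY] by simp
  finally show ?thesis using Y2 by simp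
qed

lemma pseudoinverse_eqI: "is_pseudoinverse A X \<Longrightarrow> pseudoinverse A = X"
  unfolding pseudoinverse_def by (rule the_equality) (auto intro: is_pseudoinverse_unique)

definition ones_mat :: "nat \<Rightarrow> nat \<Rightarrow> rat mat" where
  "ones_mat m n = mat m n (\<lambda>_. 1)"

definition id_rows_mat :: "nat \<Rightarrow> nat \<Rightarrow> rat mat" where
  "id_rows_mat m n = mat m n (\<lambda>(i, j). 1\<^sub>m n $$ (i, j))"

definition B_mat :: "rat \<Rightarrow> nat \<Rightarrow> nat \<Rightarrow> rat mat" where
  "B_mat \<epsilon> m n = ones_mat m n + \<epsilon> \<cdot>\<^sub>m id_rows_mat m n"

end

theory Submission
  imports Defs
begin

text \<open>
  Put \<open>D = \<epsilon>\<^sup>2 + 2\<epsilon>m + mn = (m + \<epsilon>)\<^sup>2 + m(n - m)\<close>, which is positive as soon as \<open>n > -\<epsilon>\<close>.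
  For \<open>\<epsilon> \<noteq> 0\<close> the matrix \<open>B\<close> then has full row rank, and inverting
  \<open>B B\<^sup>T = \<epsilon>\<^sup>2 I + (n + 2\<epsilon>) J\<close> (a rank-one perturbation of a multiple of the identity)
  in \<open>B\<^sup>+ = B\<^sup>T (B B\<^sup>T)\<^sup>-\<^sup>1\<close> gives the entries \<open>\<delta>\<^sub>i\<^sub>j/\<epsilon> - (\<epsilon> + n)/(\<epsilon> D)\<close> in the first \<open>m\<close> rows
  and \<open>1/D\<close> in the others; for \<open>\<epsilon> = 0\<close> all entries are \<open>1/D = 1/(mn)\<close>. Writing \<open>\<epsilon> = p/q\<close>, every
  entry is a fraction whose numerator and denominator are at most \<open>2 (\<bar>p\<bar> + q)\<^sup>3 n\<^sup>2\<close>.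
\<close>

lemma is_pseudoinverse_right_inverseI:
  fixes A X :: "'a :: linordered_field mat"
  assumes A: "A \<in> carrier_mat m n" and X: "X \<in> carrier_mat n m"
    and AX: "A * X = 1\<^sub>m m" and sym: "transpose_mat (X * A) = X * A"
  shows "is_pseudoinverse A X"
  using assms assoc_mult_mat[OF X A X] by (simp add: is_pseudoinverse_def)

lemma index_mult_mat_sum:
  assumes "A \<in> carrier_mat m n" "X \<in> carrier_mat n k" "i < m" "j < k"
  shows "(A * X) $$ (i, j) = (\<Sum>l<n. A $$ (i, l) * X $$ (l, j))"
  using assms by (auto simp: scalar_prod_def lessThan_atLeast0 intro!: sum.cong)

lemma B_mat_carrier [simp]: "B_mat \<epsilon> m n \<in> carrier_mat m n"
  by (simp add: B_mat_def ones_mat_def id_rows_mat_def)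

lemma index_B_mat:
  assumes "m \<le> n" "i < m" "j < n"
  shows "B_mat \<epsilon> m n $$ (i, j) = 1 + (if i = j then \<epsilon> else 0)"
  using assms by (simp add: B_mat_def ones_mat_def id_rows_mat_def)

definition B_den :: "rat \<Rightarrow> nat \<Rightarrow> nat \<Rightarrow> rat" where
  "B_den \<epsilon> m n = \<epsilon>\<^sup>2 + 2 * \<epsilon> * of_nat m + of_nat m * of_nat n"

definition B_pinv :: "rat \<Rightarrow> nat \<Rightarrow> nat \<Rightarrow> rat mat" where
  "B_pinv \<epsilon> m n = mat n m (\<lambda>(i, j).
     if \<epsilon> = 0 \<or> m \<le> i then 1 / B_den \<epsilon> m n
     else (if i = j then 1 / \<epsilon> else 0) - (\<epsilon> + of_nat n) / (\<epsilon> * B_den \<epsilon> m n))"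

lemma B_pinv_carrier [simp]: "B_pinv \<epsilon> m n \<in> carrier_mat n m"
  by (simp add: B_pinv_def)

lemma B_den_pos:
  assumes "1 \<le> m" "m \<le> n" "- \<epsilon> < of_nat n"
  shows "B_den \<epsilon> m n > 0"
proof -
  have eq: "B_den \<epsilon> m n = (of_nat m + \<epsilon>)\<^sup>2 + of_nat m * (of_nat n - of_nat m)"
    by (simp add: B_den_def power2_eq_square algebra_simps)
  show ?thesis
  proof (cases "m = n")
    case True
    have "of_nat m + \<epsilon> \<noteq> 0" using True assms by linarith
    then show ?thesis unfolding eq using True by simp
  next
    case False
    then have "of_nat m * (of_nat n - of_nat m :: rat) > 0"
      using assms by (intro mult_pos_pos) auto
    then show ?thesis by (simp add: eq add_nonneg_pos)
  qed
qed

lemma B_mat_mult_index: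
  assumes "m \<le> n" "X \<in> carrier_mat n k" "i < m" "j < k"
  shows "(B_mat \<epsilon> m n * X) $$ (i, j) = (\<Sum>l<n. X $$ (l, j)) + \<epsilon> * X $$ (i, j)"
proof -
  have "(B_mat \<epsilon> m n * X) $$ (i, j) = (\<Sum>l<n. (1 + (if i = l then \<epsilon> else 0)) * X $$ (l, j))"
    using assms by (simp add: index_mult_mat_sum[OF B_mat_carrier assms(2-4)] index_B_mat)
  also have "\<dots> = (\<Sum>l<n. X $$ (l, j) + (if i = l then \<epsilon> * X $$ (l, j) else 0))"
    by (intro sum.cong) (auto simp: algebra_simps)
  finally show ?thesis using assms by (simp add: sum.distrib)
qed

lemma mult_B_mat_index:
  assumes "m \<le> n" "X \<in> carrier_mat k m" "i < k" "j < n"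
  shows "(X * B_mat \<epsilon> m n) $$ (i, j)
    = (\<Sum>l<m. X $$ (i, l)) + (if j < m then \<epsilon> * X $$ (i, j) else 0)"
proof -
  have "(X * B_mat \<epsilon> m n) $$ (i, j) = (\<Sum>l<m. X $$ (i, l) * (1 + (if l = j then \<epsilon> else 0)))"
    using assms by (simp add: index_mult_mat_sum[OF assms(2) B_mat_carrier assms(3,4)] index_B_mat)
  also have "\<dots> = (\<Sum>l<m. X $$ (i, l) + (if j = l then \<epsilon> * X $$ (i, l) else 0))"
    by (intro sum.cong) (auto simp: algebra_simps)
  finally show ?thesis using assms by (simp add: sum.distrib)
qed

lemma is_pseudoinverse_B_pinv_nonzero:
  assumes \<epsilon>: "\<epsilon> \<noteq> 0" and m: "1 \<le> m" "m \<le> n" and D0: "B_den \<epsilon> m n \<noteq> 0"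
  shows "is_pseudoinverse (B_mat \<epsilon> m n) (B_pinv \<epsilon> m n)"
proof (rule is_pseudoinverse_right_inverseI[OF B_mat_carrier B_pinv_carrier])
  let ?B = "B_mat \<epsilon> m n" and ?X = "B_pinv \<epsilon> m n" and ?D = "B_den \<epsilon> m n"
  let ?c = "(\<epsilon> + of_nat n) / (\<epsilon> * ?D)"
  have X_top: "?X $$ (i, j) = (if i = j then 1 / \<epsilon> else 0) - ?c" if "i < m" "j < m" for i j
    using that m \<epsilon> by (simp add: B_pinv_def)
  have X_bot: "?X $$ (i, j) = 1 / ?D" if "m \<le> i" "i < n" "j < m" for i j
    using that by (simp add: B_pinv_def)
  have sum_top: "1 / \<epsilon> - of_nat m * ?c = (\<epsilon> + of_nat m) / ?D"
    using \<epsilon> D0 by (simp add: field_simps) (simp add: B_den_def power2_eq_square algebra_simps)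
  have row: "(\<Sum>l<m. ?X $$ (i, l)) =
      (if i < m then (\<epsilon> + of_nat m) / ?D else of_nat m / ?D)" if "i < n" for i
    using that sum_top by (simp add: X_top X_bot sum_subtractf)
  have col: "(\<Sum>l<n. ?X $$ (l, j)) = (\<epsilon> + of_nat n) / ?D" if j: "j < m" for j
  proof -
    have "(\<Sum>l<n. ?X $$ (l, j)) = (\<Sum>l<m. ?X $$ (l, j)) + (\<Sum>l=m..<n. ?X $$ (l, j))"
      using m by (simp add: lessThan_atLeast0 sum.atLeastLessThan_concat)
    also have "\<dots> = (\<epsilon> + of_nat m) / ?D + (of_nat n - of_nat m) / ?D"
      using j m sum_top by (simp add: X_top X_bot sum_subtractf of_nat_diff)
    finally show ?thesis by (simp add: add_divide_distrib[symmetric])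
  qed
  show "?B * ?X = 1\<^sub>m m"
  proof (rule eq_matI)
    fix i j assume "i < dim_row (1\<^sub>m m :: rat mat)" "j < dim_col (1\<^sub>m m :: rat mat)"
    then have ij: "i < m" "j < m" by auto
    show "(?B * ?X) $$ (i, j) = 1\<^sub>m m $$ (i, j)"
      using ij \<epsilon> D0
      by (simp add: B_mat_mult_index[OF m(2) B_pinv_carrier ij] col X_top right_diff_distrib)
  qed (use carrier_matD[OF B_mat_carrier] carrier_matD[OF B_pinv_carrier] in auto)
  have XB: "(?X * ?B) $$ (i, j) =
      (if i < m then (\<epsilon> + of_nat m) / ?D else of_nat m / ?D) +
      (if j < m then if i < m then (if i = j then 1 else 0) - (\<epsilon> + of_nat n) / ?D
                     else \<epsilon> / ?D else 0)" if ij: "i < n" "j < n" for i j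
    unfolding mult_B_mat_index[OF m(2) B_pinv_carrier ij] row[OF ij(1)]
    using ij \<epsilon> D0 by (simp add: X_top X_bot right_diff_distrib)
  have dims: "dim_row (?X * ?B) = n" "dim_col (?X * ?B) = n"
    using carrier_matD[OF B_mat_carrier] carrier_matD[OF B_pinv_carrier] by auto
  show "transpose_mat (?X * ?B) = ?X * ?B"
  proof (rule eq_matI)
    fix i j assume "i < dim_row (?X * ?B)" "j < dim_col (?X * ?B)"
    then have ij: "i < n" "j < n" unfolding dims by auto
    then have "transpose_mat (?X * ?B) $$ (i, j) = (?X * ?B) $$ (j, i)"
      by (simp add: dims del: index_mult_mat)
    also have "\<dots> = (?X * ?B) $$ (i, j)"
      unfolding XB[OF ij] XB[OF ij(2,1)] by (auto simp: add_divide_distrib)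
    finally show "transpose_mat (?X * ?B) $$ (i, j) = (?X * ?B) $$ (i, j)" .
  qed (simp_all only: index_transpose_mat dims)
qed

lemma mat_const_mult:
  "mat m n (\<lambda>_. a) * mat n k (\<lambda>_. b) = mat m k (\<lambda>_. of_nat n * a * b :: 'a :: comm_semiring_1)"
  by (rule eq_matI) (auto simp: scalar_prod_def algebra_simps)

lemma is_pseudoinverse_B_pinv_zero:
  assumes m: "1 \<le> m" "m \<le> n"
  shows "is_pseudoinverse (B_mat 0 m n) (B_pinv 0 m n)"
proof -
  have B: "B_mat 0 m n = mat m n (\<lambda>_. 1)"
    by (rule eq_matI) (auto simp: B_mat_def ones_mat_def id_rows_mat_def)
  have X: "B_pinv 0 m n = mat n m (\<lambda>_. 1 / (of_nat m * of_nat n))"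
    by (rule eq_matI) (auto simp: B_pinv_def B_den_def)
  have trans: "transpose_mat (mat k k (\<lambda>_. c)) = mat k k (\<lambda>_. c)" for k and c :: rat
    by (rule eq_matI) auto
  show ?thesis
    using m by (simp add: is_pseudoinverse_def B X mat_const_mult trans)
qed

lemma pseudoinverse_B_mat:
  assumes "1 \<le> m" "m \<le> n" "- \<epsilon> < of_nat n"
  shows "pseudoinverse (B_mat \<epsilon> m n) = B_pinv \<epsilon> m n"
  using is_pseudoinverse_B_pinv_nonzero[of \<epsilon> m n] is_pseudoinverse_B_pinv_zero[of m n]
    B_den_pos[OF assms] assms
  by (cases "\<epsilon> = 0") (auto intro!: pseudoinverse_eqI)

lemma quotient_of_abs_le:
  assumes q: "quotient_of x = (a, b)" and x: "x = of_int N / of_int M" and M: "M \<noteq> 0"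
  shows "\<bar>a\<bar> \<le> \<bar>N\<bar>" "\<bar>b\<bar> \<le> \<bar>M\<bar>"
proof -
  have b: "b > 0" and cop: "coprime a b" and xab: "x = of_int a / of_int b"
    using quotient_of_denom_pos[OF q] quotient_of_coprime[OF q] quotient_of_div[OF q] by auto
  have "of_int (a * M) = (of_int (N * b) :: rat)"
    using xab x b M by (simp add: field_simps)
  then have eq: "a * M = N * b" by linarith
  have "b dvd M" using cop eq by (metis coprime_commute coprime_dvd_mult_right_iff dvd_triv_right)
  then show "\<bar>b\<bar> \<le> \<bar>M\<bar>" using M by (simp add: dvd_imp_le_int)
  have "a dvd N" using cop eq by (metis coprime_dvd_mult_left_iff dvd_triv_left)
  then show "\<bar>a\<bar> \<le> \<bar>N\<bar>"
    using eq M b by (cases "N = 0") (auto simp: dvd_imp_le_int)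
qed

lemma RES_nonneg: "0 \<le> RES x"
proof -
  obtain a b where q: "quotient_of x = (a, b)" by fastforce
  have "0 \<le> log 2 \<bar>real_of_int (b + 1)\<bar>" using quotient_of_denom_pos[OF q] by simp
  then show ?thesis by (simp add: RES_def q le_max_iff_disj)
qed

lemma RES_le_log:
  fixes h :: real
  assumes x: "x = of_int N / of_int M" and M: "M \<noteq> 0"
    and h: "real_of_int \<bar>N\<bar> \<le> h" "real_of_int \<bar>M\<bar> \<le> h"
  shows "real_of_int (RES x) \<le> log 2 h + 2"
proof -
  obtain a b where q: "quotient_of x = (a, b)" by fastforce
  have ab: "\<bar>real_of_int a\<bar> \<le> h" "\<bar>real_of_int b\<bar> \<le> h"
    using quotient_of_abs_le[OF q x M] h by linarith+
  have "1 \<le> \<bar>M\<bar>" using M by simp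
  then have h1: "1 \<le> h" using h(2) by linarith
  have le: "log 2 \<bar>real_of_int (c + 1)\<bar> \<le> log 2 h + 1" if "\<bar>real_of_int c\<bar> \<le> h" for c
  proof (cases "c + 1 = 0")
    case True
    have "log 2 0 = (0 :: real)" by (simp add: log_def)
    moreover have "0 \<le> log 2 h" using h1 by simp
    ultimately show ?thesis by (simp only: True) simp
  next
    case False
    have "log 2 \<bar>real_of_int (c + 1)\<bar> \<le> log 2 (2 * h)"
      using False that h1 by (subst log_le_cancel_iff) linarith+
    then show ?thesis using h1 by (simp add: log_mult)
  qed
  show ?thesis using le[OF ab(1)] le[OF ab(2)] by (simp add: RES_def q) linarith
qed

lemma B_pinv_entry_fraction:
  fixes p q :: int
  assumes \<epsilon>: "\<epsilon> = of_int p / of_int q" and q: "q > 0" and m: "1 \<le> m" "m \<le> n"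
    and D: "B_den \<epsilon> m n \<noteq> 0" and ij: "i < n" "j < m"
  obtains N M :: int where "B_pinv \<epsilon> m n $$ (i, j) = of_int N / of_int M" "M \<noteq> 0"
    "\<bar>N\<bar> \<le> 2 * (\<bar>p\<bar> + q) ^ 3 * int n ^ 2" "\<bar>M\<bar> \<le> 2 * (\<bar>p\<bar> + q) ^ 3 * int n ^ 2"
proof -
  define s where "s = \<bar>p\<bar> + q"
  define E where "E = p\<^sup>2 + 2 * p * q * int m + q\<^sup>2 * (int m * int n)"
  have DE: "B_den \<epsilon> m n = of_int E / (of_int q)\<^sup>2"
    using q by (simp add: B_den_def \<epsilon> E_def power2_eq_square field_simps)
  have E0: "E \<noteq> 0" using D DE by auto
  have s: "\<bar>p\<bar> \<le> s" "q \<le> s" "1 \<le> s" using q by (auto simp: s_def)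
  have n: "1 \<le> int n" using m by linarith
  have n2: "int n \<le> int n ^ 2" "1 \<le> int n ^ 2"
    using n by (auto simp: self_le_power)
  have s23: "s ^ 2 \<le> s ^ 3" using s by (intro power_increasing) auto
  have E_le: "\<bar>E\<bar> \<le> s ^ 2 * int n ^ 2"
  proof -
    have m_le: "int m \<le> int n ^ 2" using m n2 by linarith
    have mn_le: "int m * int n \<le> int n ^ 2"
      using m by (auto simp: power2_eq_square intro: mult_right_mono)
    have "\<bar>E\<bar> \<le> \<bar>p\<bar>\<^sup>2 + 2 * (\<bar>p\<bar> * q) * int m + q\<^sup>2 * (int m * int n)"
      unfolding E_def using q
      by (intro order_trans[OF abs_triangle_ineq] add_mono) (auto simp: abs_mult)
    also have "\<dots> \<le> \<bar>p\<bar>\<^sup>2 * int n ^ 2 + 2 * (\<bar>p\<bar> * q) * int n ^ 2 + q\<^sup>2 * int n ^ 2"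
      using q mult_left_mono[OF n2(2), of "\<bar>p\<bar>\<^sup>2"] mult_left_mono[OF m_le, of "2 * (\<bar>p\<bar> * q)"]
        mult_left_mono[OF mn_le, of "q\<^sup>2"]
      by (intro add_mono) auto
    also have "\<dots> = s ^ 2 * int n ^ 2"
      by (simp add: s_def power2_eq_square algebra_simps)
    finally show ?thesis .
  qed
  have bnd: "s ^ 2 * int n ^ 2 \<le> 2 * s ^ 3 * int n ^ 2"
    using s23 zero_le_power[of s 3] s(3) n2(2) by (intro mult_right_mono) linarith+
  show thesis
  proof (cases "\<epsilon> = 0 \<or> m \<le> i")
    case True
    have "q\<^sup>2 * 1 \<le> s\<^sup>2 * int n ^ 2"
      using q s n2 by (intro mult_mono power_mono) auto
    then have N: "\<bar>q\<^sup>2\<bar> \<le> 2 * s ^ 3 * int n ^ 2" using bnd by simp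
    have eq: "B_pinv \<epsilon> m n $$ (i, j) = of_int (q\<^sup>2) / of_int E"
      using True ij by (auto simp: B_pinv_def DE)
    show thesis
      using that[OF eq E0 N[unfolded s_def] order_trans[OF E_le bnd, unfolded s_def]] .
  next
    case False
    define d :: int where "d = (if i = j then 1 else 0)"
    have p0: "p \<noteq> 0" using False \<epsilon> by auto
    have "B_pinv \<epsilon> m n $$ (i, j) = of_int d / \<epsilon> - (\<epsilon> + of_nat n) / (\<epsilon> * B_den \<epsilon> m n)"
      using False ij by (simp add: B_pinv_def d_def)
    also have "\<dots> = of_int (q * (d * E - q * (p + int n * q))) / of_int (p * E)"
      unfolding DE unfolding \<epsilon> using p0 E0 q by (simp add: field_simps power2_eq_square)
    finally have eq: "B_pinv \<epsilon> m n $$ (i, j) = \<dots>" .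
    have "\<bar>p * E\<bar> \<le> s * (s ^ 2 * int n ^ 2)"
      unfolding abs_mult using s E_le by (intro mult_mono) auto
    then have M: "\<bar>p * E\<bar> \<le> 2 * s ^ 3 * int n ^ 2"
      by (simp add: power2_eq_square power3_eq_cube algebra_simps)
    have "\<bar>p + int n * q\<bar> \<le> \<bar>p\<bar> * int n + q * int n"
      using n q mult_left_mono[OF n, of "\<bar>p\<bar>"]
      by (intro order_trans[OF abs_triangle_ineq] add_mono) (auto simp: abs_mult)
    also have "\<dots> \<le> s * int n ^ 2"
      using s n2 mult_left_mono[OF n2(1), of s] by (simp add: s_def algebra_simps)
    finally have "q * \<bar>p + int n * q\<bar> \<le> s * (s * int n ^ 2)"
      using s q by (intro mult_mono) auto
    then have "\<bar>q * (p + int n * q)\<bar> \<le> s ^ 2 * int n ^ 2"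
      using q by (simp add: abs_mult power2_eq_square mult.assoc)
    moreover have "\<bar>d * E\<bar> \<le> s ^ 2 * int n ^ 2"
      using E_le by (auto simp: d_def intro: order_trans[OF abs_ge_zero])
    ultimately have "\<bar>d * E - q * (p + int n * q)\<bar> \<le> 2 * (s ^ 2 * int n ^ 2)"
      by linarith
    then have "\<bar>q * (d * E - q * (p + int n * q))\<bar> \<le> s * (2 * (s ^ 2 * int n ^ 2))"
      unfolding abs_mult[of q] using s q by (intro mult_mono) auto
    then have N: "\<bar>q * (d * E - q * (p + int n * q))\<bar> \<le> 2 * s ^ 3 * int n ^ 2"
      by (simp add: power2_eq_square power3_eq_cube algebra_simps)
    show thesis using that[OF eq _ N[unfolded s_def] M[unfolded s_def]] p0 E0 by simp
  qed
qed

lemma RES_mat_bounds: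
  assumes A: "A \<in> carrier_mat n m" and pos: "0 < n" "0 < m"
    and le: "\<And>i j. i < n \<Longrightarrow> j < m \<Longrightarrow> real_of_int (RES (A $$ (i, j))) \<le> c"
  shows "0 \<le> RES_mat A" "real_of_int (RES_mat A) \<le> c"
proof -
  let ?S = "{RES (A $$ (i, j)) | i j. i < dim_row A \<and> j < dim_col A}"
  have "?S = (\<lambda>(i, j). RES (A $$ (i, j))) ` ({..<n} \<times> {..<m})"
    using A by auto
  then have "finite ?S" "?S \<noteq> {}" using pos by auto
  from Max_in[OF this] obtain i j where "i < n" "j < m" "RES_mat A = RES (A $$ (i, j))"
    using A unfolding RES_mat_def by auto
  then show "0 \<le> RES_mat A" "real_of_int (RES_mat A) \<le> c"
    using le RES_nonneg by auto
qed

theorem theorem5: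
  fixes \<epsilon> :: rat
  shows "(\<lambda>(m, n). real_of_int (RES_mat (pseudoinverse (B_mat \<epsilon> m n))))
    \<in> O[inf (filtercomap snd at_top) (principal {(m :: nat, n :: nat). 1 \<le> m \<and> m \<le> n})](\<lambda>(m, n). log 2 (real n))"
proof -
  obtain p q where pq: "quotient_of \<epsilon> = (p, q)" by fastforce
  have q: "q > 0" and \<epsilon>: "\<epsilon> = of_int p / of_int q"
    using quotient_of_denom_pos[OF pq] quotient_of_div[OF pq] by auto
  define C :: real where "C = 2 * real_of_int (\<bar>p\<bar> + q) ^ 3"
  have "1 \<le> real_of_int (\<bar>p\<bar> + q) ^ 3"
    using q by (intro one_le_power) linarith
  then have C: "1 \<le> C" by (simp add: C_def)
  obtain n0 :: nat where n0: "- \<epsilon> < of_nat n0" using reals_Archimedean2 by blast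
  have key: "norm (real_of_int (RES_mat (pseudoinverse (B_mat \<epsilon> m n))))
      \<le> (log 2 C + 4) * norm (log 2 (real n))"
    if m: "1 \<le> m" "m \<le> n" and n: "max 2 n0 \<le> n" for m n
  proof -
    have large: "- \<epsilon> < of_nat n"
      using n0 n by (meson le_max_iff_disj less_le_trans of_nat_le_iff max.bounded_iff)
    have "real_of_int (RES (B_pinv \<epsilon> m n $$ (i, j))) \<le> log 2 (C * real n ^ 2) + 2"
      if ij: "i < n" "j < m" for i j
    proof -
      have "B_den \<epsilon> m n \<noteq> 0" using B_den_pos[OF m large] by simp
      from B_pinv_entry_fraction[OF \<epsilon> q m this ij] obtain N M :: int where
        NM: "B_pinv \<epsilon> m n $$ (i, j) = of_int N / of_int M" "M \<noteq> 0"
        "\<bar>N\<bar> \<le> 2 * (\<bar>p\<bar> + q) ^ 3 * int n ^ 2" "\<bar>M\<bar> \<le> 2 * (\<bar>p\<bar> + q) ^ 3 * int n ^ 2" .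
      have C_eq: "C * real n ^ 2 = real_of_int (2 * (\<bar>p\<bar> + q) ^ 3 * int n ^ 2)"
        by (simp add: C_def)
      show ?thesis
        using NM(3,4) by (intro RES_le_log[OF NM(1,2)]) (simp_all only: C_eq of_int_le_iff)
    qed
    note bounds = RES_mat_bounds[OF B_pinv_carrier _ _ this]
    have l1: "1 \<le> log 2 (real n)" using n by simp
    have "0 \<le> log 2 C" using C by simp
    have "real_of_int (RES_mat (B_pinv \<epsilon> m n)) \<le> log 2 (C * real n ^ 2) + 2"
      using bounds(2) m by simp
    also have "\<dots> = (log 2 C + 2) * 1 + 2 * log 2 (real n)"
      using C n by (simp add: log_mult log_nat_power)
    also have "\<dots> \<le> (log 2 C + 2) * log 2 (real n) + 2 * log 2 (real n)"
      using l1 \<open>0 \<le> log 2 C\<close> by (intro add_right_mono mult_left_mono) auto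
    finally show ?thesis
      using l1 bounds(1) m by (simp add: pseudoinverse_B_mat[OF m large] algebra_simps)
  qed
  have ev: "eventually (\<lambda>x. max 2 n0 \<le> snd x) (filtercomap snd at_top)"
    by (rule eventually_filtercomapI) (rule eventually_ge_at_top)
  show ?thesis
    by (intro bigoI[of _ "log 2 C + 4"])
      (unfold eventually_inf_principal, rule eventually_mono[OF ev], use key in auto)
qed

end
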